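(* Let $r \ge 2$, let $d_i \ge 2$ be integers and $D_i = [d_i]$ for $i \in [r]$. Let $c_i : D_i \to \mathbf{R}_+$ for $i \in [r]$ and $c_{ij} : D_i \times D_j \to \mathbf{R}_+\cup\{+\infty\}$ for distinct $i,j \in [r]$ with $c_{ij}(a,b) = c_{ji}(b,a)$, and let $$f(x_1,\dots,x_r) = \sum_{i\in[r]} c_i(x_i) + \sum_{1\le i<j\le r} c_{ij}(x_i,x_j).$$ Let $U = \{(i,a) : i \in [r],\ a \in D_i\}$ and define $H = (h_{(i,a),(j,b)})$, indexed by unordered pairs of distinct elements of $U$, by $h_{(i,a),(j,b)} = c_{ij}(a,b)$ if $i \ne j$ and $h_{(i,a),(j,b)}$ undefined if $i = j$. Then $H$ is M${}^\natural$-convex completable if and only if $f$ satisfies the joint winner property and is Z-free.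
   Context: Conventions: $a<+\infty$, $a+(+\infty)=+\infty$ for $a\in\mathbf{R}$, $0\cdot(+\infty)=0$; $\mathbf{R}_+$ is the set of nonnegative reals. $f$ satisfies the joint winner property (JWP) if $c_{ij}(a,b) \ge \min\{c_{jk}(b,c), c_{ik}(a,c)\}$ for all distinct $i,j,k\in[r]$ and all $a\in D_i, b\in D_j, c\in D_k$. A function $f$ with the JWP is Z-free if for all distinct $i,j \in [r]$, all distinct $a,b \in D_i$ and all distinct $c,d \in D_j$, the minimum of the four values $c_{ij}(a,c), c_{ij}(a,d), c_{ij}(b,c), c_{ij}(b,d)$ is attained by at least two of these four entries. For a finite index set $N$, a function $g : \{0,1\}^N \to \mathbf{R}\cup\{+\infty\}$ is M${}^\natural$-convex if for all $x,y$ and all $u$ with $x_u > y_u$ there exists $v \in \{v : y_v > x_v\}\cup\{0\}$ with $g(x)+g(y) \ge g(x-\chi_u+\chi_v)+g(y+\chi_u-\chi_v)$ ($\chi_u$ the unit vector, $\chi_0=0$). A family $H$ of entries indexed by unordered pairs of distinct elements of $N$, each either in $\mathbf{R}\cup\{+\infty\}$ or undefined, is M${}^\natural$-convex completable if values in $\mathbf{R}\cup\{+\infty\}$ can be assigned to the undefined entries so that, for some real numbers $(h_u)_{u\in N}$, the function $x \mapsto \sum_u h_u x_u + \sum_{\{u,v\}} h_{uv}x_ux_v$ on $\{0,1\}^N$ is M${}^\natural$-convex. *)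

theory Defs
  imports "HOL-Library.Extended_Real" "HOL-Library.FuncSet"
begin

text \<open>
  Values in \<open>\<real> \<union> {+\<infinity>}\<close> are extended reals different from \<open>-\<infinity>\<close>; the arithmetic of
  \<^typ>\<open>ereal\<close> satisfies \<open>a + \<infinity> = \<infinity>\<close> for these values, and \<open>0 * \<infinity> = 0\<close>.
\<close>

text \<open>
  The joint winner property and Z-freeness are properties of a function together with its given
  decomposition into unary and binary cost functions; only the binary costs \<open>c i j a b\<close>
  (that is, \<open>c\<^sub>i\<^sub>j(a, b)\<close>) matter.
\<close>

definition joint_winner_property ::
    "nat \<Rightarrow> (nat \<Rightarrow> nat set) \<Rightarrow> (nat \<Rightarrow> nat \<Rightarrow> nat \<Rightarrow> nat \<Rightarrow> ereal) \<Rightarrow> bool" where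
  "joint_winner_property r D c \<longleftrightarrow>
    (\<forall>i\<in>{1..r}. \<forall>j\<in>{1..r}. \<forall>k\<in>{1..r}. i \<noteq> j \<and> j \<noteq> k \<and> i \<noteq> k \<longrightarrow>
      (\<forall>a\<in>D i. \<forall>b\<in>D j. \<forall>e\<in>D k. c i j a b \<ge> min (c j k b e) (c i k a e)))"

text \<open>The minimizing positions, not the values, are counted.\<close>

definition Z_free ::
    "nat \<Rightarrow> (nat \<Rightarrow> nat set) \<Rightarrow> (nat \<Rightarrow> nat \<Rightarrow> nat \<Rightarrow> nat \<Rightarrow> ereal) \<Rightarrow> bool" where
  "Z_free r D c \<longleftrightarrow>
    (\<forall>i\<in>{1..r}. \<forall>j\<in>{1..r}. i \<noteq> j \<longrightarrow>
      (\<forall>a\<in>D i. \<forall>b\<in>D i. \<forall>p\<in>D j. \<forall>q\<in>D j. a \<noteq> b \<and> p \<noteq> q \<longrightarrow>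
        2 \<le> card {(s, t) \<in> {a, b} \<times> {p, q}.
                    c i j s t = Min {c i j a p, c i j a q, c i j b p, c i j b q}}))"

text \<open>\<open>None\<close> plays the role of the extra index \<open>0\<close>, whose unit vector is zero.\<close>

definition unit_vec :: "'a option \<Rightarrow> 'a \<Rightarrow> int" where
  "unit_vec v w = (if v = Some w then 1 else 0)"

text \<open>
  \<open>{0,1}\<^sup>N\<close> is \<open>N \<rightarrow>\<^sub>E {0, 1}\<close>. The shifted vectors below again belong to this set: they
  change their argument only inside \<open>N\<close>.
\<close>

definition M_natural_convex :: "'a set \<Rightarrow> (('a \<Rightarrow> int) \<Rightarrow> ereal) \<Rightarrow> bool" where
  "M_natural_convex N g \<longleftrightarrow>
    finite N \<and>
    (\<forall>x \<in> N \<rightarrow>\<^sub>E {0, 1}. g x \<noteq> -\<infinity>) \<and>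
    (\<forall>x \<in> N \<rightarrow>\<^sub>E {0, 1}. \<forall>y \<in> N \<rightarrow>\<^sub>E {0, 1}. \<forall>u\<in>N. x u > y u \<longrightarrow>
      (\<exists>v \<in> Some ` {v \<in> N. y v > x v} \<union> {None}.
        g x + g y \<ge> g (\<lambda>w. x w - unit_vec (Some u) w + unit_vec v w) +
                    g (\<lambda>w. y w + unit_vec (Some u) w - unit_vec v w)))"

definition unordered_pairs :: "'a set \<Rightarrow> 'a set set" where
  "unordered_pairs N = {e. e \<subseteq> N \<and> card e = 2}"

text \<open>In the quadratic part the product over \<open>e = {u, v}\<close> is \<open>x\<^sub>u x\<^sub>v\<close>.\<close>

definition quadratic_fun ::
    "'a set \<Rightarrow> ('a \<Rightarrow> real) \<Rightarrow> ('a set \<Rightarrow> ereal) \<Rightarrow> ('a \<Rightarrow> int) \<Rightarrow> ereal" where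
  "quadratic_fun N l h x =
    (\<Sum>u\<in>N. ereal (l u * of_int (x u))) +
    (\<Sum>e\<in>unordered_pairs N. h e * ereal (of_int (\<Prod>w\<in>e. x w)))"

text \<open>
  A partially defined family is given by its (symmetric) table \<open>H u v\<close> of entries, with
  \<open>None\<close> for an undefined one. The completion \<open>h\<close> is indexed by two-element sets and has to
  agree with every defined entry.
\<close>

definition M_natural_convex_completable :: "'a set \<Rightarrow> ('a \<Rightarrow> 'a \<Rightarrow> ereal option) \<Rightarrow> bool" where
  "M_natural_convex_completable N H \<longleftrightarrow>
    (\<exists>h. (\<forall>e\<in>unordered_pairs N. h e \<noteq> -\<infinity>) \<and>
         (\<forall>u\<in>N. \<forall>v\<in>N. \<forall>t. u \<noteq> v \<and> H u v = Some t \<longrightarrow> h {u, v} = t) \<and>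
         (\<exists>l. M_natural_convex N (quadratic_fun N l h)))"

definition cost_family ::
    "(nat \<Rightarrow> nat \<Rightarrow> nat \<Rightarrow> nat \<Rightarrow> ereal) \<Rightarrow> nat \<times> nat \<Rightarrow> nat \<times> nat \<Rightarrow> ereal option" where
  "cost_family c = (\<lambda>(i, a) (j, b). if i \<noteq> j then Some (c i j a b) else None)"

end

theory Submission
  imports Defs
begin

text \<open>
  A quadratic function on the cube is M-natural-convex as soon as its coefficients are nonnegative
  and anti-ultrametric, \<open>h\<^sub>u\<^sub>w \<ge> min h\<^sub>u\<^sub>v h\<^sub>v\<^sub>w\<close>, and the anti-ultrametric inequality is
  conversely the exchange axiom for \<open>{u, w}\<close> and \<open>{v}\<close>. The joint winner property is this
  inequality for three different parts, and Z-freeness follows from two triangles sharing an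
  undefined entry. To complete \<open>H\<close>, give \<open>u, v\<close> in the same part the best bottleneck
  value \<open>min h\<^sub>u\<^sub>w h\<^sub>v\<^sub>w\<close> over all \<open>w\<close> outside that part.

  For the exchange axiom, remove \<open>u\<close> from \<open>X\<close>, let \<open>A = X - {u} - Y\<close> and \<open>B = Y - X\<close>,
  and compare sums by counting, for each level \<open>s\<close>, the summands that are at least \<open>s\<close>. If at
  every level the cluster of \<open>u\<close> contains at least as many points of \<open>A\<close> as of \<open>B\<close>, then \<open>u\<close>
  can be moved to \<open>Y\<close>. Otherwise \<open>u\<close> is exchanged with some \<open>v\<close> in \<open>B\<close>, as close to \<open>u\<close> as
  possible, whose clusters at the levels \<open>s \<ge> h\<^sub>u\<^sub>v\<close> all contain more points of \<open>B\<close> than of \<open>A\<close>.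
\<close>

section \<open>Comparing sums through level counts\<close>

text \<open>Greedy matching: a point \<open>a\<close> with the largest value \<open>m\<close> is
  paired with some \<open>b\<close> of value at least \<open>m\<close>. Removing both lowers the two
  counts by one at each level \<open>s \<le> m\<close>, and above \<open>m\<close> the left count is
  zero. Nonnegativity of \<open>g\<close> takes care of the unmatched points of
  \<open>B\<close>.\<close>

lemma sum_le_of_level_counts:
  fixes f :: "'a \<Rightarrow> ereal" and g :: "'b \<Rightarrow> ereal"
  assumes "finite A" "finite B"
    and "\<And>s. card {a \<in> A. s \<le> f a} \<le> card {b \<in> B. s \<le> g b}"
    and "\<And>b. b \<in> B \<Longrightarrow> 0 \<le> g b"
  shows "sum f A \<le> sum g B"
  using assms
proof (induction "card A" arbitrary: A B)
  case 0
  then show ?case by (simp add: sum_nonneg)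
next
  case (Suc n)
  have "A \<noteq> {}" using Suc.hyps(2) by auto
  define m where "m = Max (f ` A)"
  have "m \<in> f ` A" unfolding m_def using Suc.prems(1) \<open>A \<noteq> {}\<close> by (intro Max_in) auto
  then obtain a where a: "a \<in> A" "f a = m" by auto
  have le_m: "f x \<le> m" if "x \<in> A" for x
    unfolding m_def using that Suc.prems(1) by simp
  have "card {x \<in> A. m \<le> f x} > 0"
    using a Suc.prems(1) by (auto simp: card_gt_0_iff)
  then have "card {b \<in> B. m \<le> g b} > 0"
    using Suc.prems(3)[of m] by linarith
  then obtain b where b: "b \<in> B" "m \<le> g b"
    by (auto simp: card_gt_0_iff)
  have "sum f (A - {a}) \<le> sum g (B - {b})"
  proof (rule Suc.hyps(1))
    show "n = card (A - {a})" using Suc.hyps(2) Suc.prems(1) a by simp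
    fix s
    show "card {x \<in> A - {a}. s \<le> f x} \<le> card {x \<in> B - {b}. s \<le> g x}"
    proof (cases "s \<le> m")
      case True
      have "{x \<in> A - {a}. s \<le> f x} = {x \<in> A. s \<le> f x} - {a}"
        "{x \<in> B - {b}. s \<le> g x} = {x \<in> B. s \<le> g x} - {b}" by auto
      moreover have "a \<in> {x \<in> A. s \<le> f x}" "b \<in> {x \<in> B. s \<le> g x}"
        using True a b by auto
      ultimately show ?thesis using Suc.prems(3)[of s] by (simp add: diff_le_mono)
    next
      case False
      then have none: "{x \<in> A - {a}. s \<le> f x} = {}"
        using le_m by (auto dest: order_trans)
      show ?thesis unfolding none by simp
    qed
  qed (use Suc.prems in auto)
  then have "f a + sum f (A - {a}) \<le> g b + sum g (B - {b})"
    using a b by (intro add_mono) auto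
  then show ?case
    using a b Suc.prems by (simp add: sum.remove)
qed

section \<open>Z-freeness as an inequality\<close>

text \<open>The minimum is attained twice exactly when no position is strictly below all others; for
  the converse, the condition at one minimizer yields a second one.\<close>

lemma two_le_card_argmin_iff:
  fixes f :: "'a \<Rightarrow> 'b::linorder"
  assumes "finite S" "S \<noteq> {}"
  shows "2 \<le> card {x \<in> S. f x = Min (f ` S)} \<longleftrightarrow> (\<forall>x\<in>S. \<exists>y\<in>S - {x}. f y \<le> f x)"
    (is "2 \<le> card ?M \<longleftrightarrow> ?R")
proof
  assume M: "2 \<le> card ?M"
  show ?R
  proof
    fix x assume "x \<in> S"
    have "\<not> ?M \<subseteq> {x}"
      using M card_mono[of "{x}" ?M] by auto
    then obtain y where "y \<in> S" "f y = Min (f ` S)" "y \<noteq> x" by blast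
    then show "\<exists>y\<in>S - {x}. f y \<le> f x"
      using \<open>x \<in> S\<close> assms(1) by (intro bexI[of _ y]) auto
  qed
next
  assume R: ?R
  have "Min (f ` S) \<in> f ` S" using assms by (intro Min_in) auto
  then obtain x where x: "x \<in> S" "f x = Min (f ` S)" by auto
  obtain y where y: "y \<in> S" "y \<noteq> x" "f y \<le> f x" using R x(1) by auto
  have "f y = Min (f ` S)"
    using x y assms(1) by (intro antisym) auto
  then have "{x, y} \<subseteq> ?M" using x y by auto
  then have "card {x, y} \<le> card ?M" using assms(1) by (intro card_mono) auto
  then show "2 \<le> card ?M" using y(2) by simp
qed

text \<open>No corner of a two-by-two block may be the unique minimum. Swapping \<open>a\<close>
  with \<open>b\<close> and \<open>p\<close> with \<open>q\<close> moves any corner to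
  \<open>(a, p)\<close>, so the inequality for this corner suffices.\<close>

lemma Z_free_altdef:
  "Z_free r D c \<longleftrightarrow>
    (\<forall>i\<in>{1..r}. \<forall>j\<in>{1..r}. i \<noteq> j \<longrightarrow>
      (\<forall>a\<in>D i. \<forall>b\<in>D i. \<forall>p\<in>D j. \<forall>q\<in>D j. a \<noteq> b \<and> p \<noteq> q \<longrightarrow>
        min (c i j a q) (min (c i j b p) (c i j b q)) \<le> c i j a p))"
proof -
  have count: "2 \<le> card {(s, t) \<in> {a, b} \<times> {p, q}.
                    F s t = Min {F a p, F a q, F b p, F b q}} \<longleftrightarrow>
      min (F a q) (min (F b p) (F b q)) \<le> F a p \<and>
      min (F a p) (min (F b q) (F b p)) \<le> F a q \<and>
      min (F b q) (min (F a p) (F a q)) \<le> F b p \<and>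
      min (F b p) (min (F a q) (F a p)) \<le> F b q"
    if "a \<noteq> b" "p \<noteq> q" for F :: "nat \<Rightarrow> nat \<Rightarrow> ereal" and a b p q
  proof -
    let ?S = "{a, b} \<times> {p, q}"
    have eq: "{(s, t) \<in> ?S. F s t = Min {F a p, F a q, F b p, F b q}} =
        {x \<in> ?S. case_prod F x = Min (case_prod F ` ?S)}"
    proof -
      have "case_prod F ` ?S = {F a p, F a q, F b p, F b q}" by auto
      then show ?thesis by auto
    qed
    have S: "?S = {(a, p), (a, q), (b, p), (b, q)}" by auto
    \<comment> \<open>The remaining corners are listed in the order in which the minima in
      \<open>count\<close> are nested, so that rewriting alone matches the two sides.\<close>
    have "?S - {(a, p)} = {(a, q), (b, p), (b, q)}" "?S - {(a, q)} = {(a, p), (b, q), (b, p)}"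
      "?S - {(b, p)} = {(b, q), (a, p), (a, q)}" "?S - {(b, q)} = {(b, p), (a, q), (a, p)}"
      using that by auto
    note remove = this[unfolded S]
    have "2 \<le> card {x \<in> ?S. case_prod F x = Min (case_prod F ` ?S)} \<longleftrightarrow>
        (\<forall>x\<in>?S. \<exists>y\<in>?S - {x}. case_prod F y \<le> case_prod F x)"
      by (rule two_le_card_argmin_iff) auto
    then show ?thesis
      unfolding eq unfolding S by (simp only: ball_simps bex_simps remove prod.case min_le_iff_disj simp_thms)
  qed
  show ?thesis (is "_ \<longleftrightarrow> ?R")
  proof
    assume Z: "Z_free r D c"
    show ?R
    proof (intro ballI impI)
      fix i j a b p q
      assume *: "i \<in> {1..r}" "j \<in> {1..r}" "i \<noteq> j" "a \<in> D i" "b \<in> D i" "p \<in> D j" "q \<in> D j"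
        "a \<noteq> b \<and> p \<noteq> q"
      show "min (c i j a q) (min (c i j b p) (c i j b q)) \<le> c i j a p"
        using Z[unfolded Z_free_def, rule_format, OF *] * count[of a b p q "c i j"] by blast
    qed
  next
    assume R: ?R
    show "Z_free r D c"
      unfolding Z_free_def
    proof (intro ballI impI)
      fix i j a b p q
      assume *: "i \<in> {1..r}" "j \<in> {1..r}" "i \<noteq> j" "a \<in> D i" "b \<in> D i" "p \<in> D j" "q \<in> D j"
        "a \<noteq> b \<and> p \<noteq> q"
      have "min (c i j s v) (min (c i j t u) (c i j t v)) \<le> c i j s u"
        if "s \<in> D i" "t \<in> D i" "u \<in> D j" "v \<in> D j" "s \<noteq> t" "u \<noteq> v" for s t u v
        using R that * by blast
      then show "2 \<le> card {(s, t) \<in> {a, b} \<times> {p, q}.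
          c i j s t = Min {c i j a p, c i j a q, c i j b p, c i j b q}}"
        using * count[of a b p q "c i j"] by simp
    qed
  qed
qed

section \<open>Clusters and the exchange inequality\<close>

text \<open>
  With the convention \<open>k u u = \<infinity>\<close> every relation \<open>s \<le> k u v\<close> is an equivalence; its classes
  \<open>{w. s \<le> k v w}\<close>, the clusters of level \<open>s\<close>, form a laminar family.
\<close>

locale anti_ultrametric =
  fixes N :: "'a set" and k :: "'a \<Rightarrow> 'a \<Rightarrow> ereal"
  assumes finite_N: "finite N"
    and self: "\<And>u. k u u = \<infinity>"
    and sym: "\<And>u v. k u v = k v u"
    and tri: "\<And>u v w. u \<in> N \<Longrightarrow> v \<in> N \<Longrightarrow> w \<in> N \<Longrightarrow> min (k u v) (k v w) \<le> k u w"
    and nonneg: "\<And>u v. u \<in> N \<Longrightarrow> v \<in> N \<Longrightarrow> 0 \<le> k u v"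
begin

lemma level_trans:
  "s \<le> k u v \<Longrightarrow> s \<le> k v w \<Longrightarrow> u \<in> N \<Longrightarrow> v \<in> N \<Longrightarrow> w \<in> N \<Longrightarrow> s \<le> k u w"
  using tri[of u v w] by (meson min.boundedI order_trans)

lemma level_eq:
  assumes "s \<le> k u v" "u \<in> N" "v \<in> N" "w \<in> N"
  shows "s \<le> k u w \<longleftrightarrow> s \<le> k v w"
  using assms level_trans[of s u v w] level_trans[of s v u w] sym by metis

definition cluster :: "'a \<Rightarrow> ereal \<Rightarrow> 'a set" where
  "cluster v s = {w \<in> N. s \<le> k v w}"

text \<open>
  Greedy removal: the maximal bad clusters are disjoint, so removing one of them keeps all
  remaining points of \<open>B\<close> inside bad clusters.
\<close>

lemma card_le_if_bad_clusters:
  assumes "A \<subseteq> N" "B \<subseteq> N"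
    and "\<And>v. v \<in> B \<Longrightarrow> \<exists>s. card (B \<inter> cluster v s) \<le> card (A \<inter> cluster v s)"
  shows "card B \<le> card A"
  using assms
proof (induction "card B" arbitrary: A B rule: less_induct)
  case less
  show ?case
  proof (cases "B = {}")
    case False
    have fin: "finite A" "finite B"
      using less.prems finite_N by (auto intro: finite_subset)
    define bad where "bad = {C. \<exists>v\<in>B. \<exists>s. C = cluster v s \<and> card (B \<inter> C) \<le> card (A \<inter> C)}"
    have "bad \<noteq> {}" using False less.prems(3) unfolding bad_def by blast
    moreover have "bad \<subseteq> Pow N" unfolding bad_def cluster_def by auto
    then have "finite bad" using finite_N by (meson finite_Pow_iff finite_subset)
    ultimately obtain C where C: "C \<in> bad" and max: "\<And>C'. C' \<in> bad \<Longrightarrow> C \<subseteq> C' \<Longrightarrow> C' = C"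
      using finite_has_maximal[of bad] by metis
    obtain v s where v: "v \<in> B" "C = cluster v s" and le: "card (B \<inter> C) \<le> card (A \<inter> C)"
      using C unfolding bad_def by blast
    have vC: "v \<in> C" using v less.prems self by (auto simp: cluster_def)
    have "card (B - C) \<le> card (A - C)"
    proof (rule less.hyps)
      show "card (B - C) < card B"
        using v vC fin by (intro psubset_card_mono) auto
      fix v' assume v': "v' \<in> B - C"
      then obtain s' where s': "card (B \<inter> cluster v' s') \<le> card (A \<inter> cluster v' s')"
        using less.prems(3) by blast
      let ?C' = "cluster v' s'"
      have N: "v \<in> N" "v' \<in> N" using v v' less.prems by auto
      have v'C': "v' \<in> ?C'" using N self by (auto simp: cluster_def)
      have "C \<inter> ?C' = {}"
      proof (rule ccontr)
        assume "C \<inter> ?C' \<noteq> {}"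
        then obtain w where w: "w \<in> N" "s \<le> k v w" "s' \<le> k v' w"
          using v by (auto simp: cluster_def)
        \<comment> \<open>A common point \<open>w\<close> forces \<open>s' \<le> s\<close>, since
          otherwise level \<open>s\<close> would connect \<open>v\<close> with \<open>v'\<close>
          through \<open>w\<close>. Then the bad cluster \<open>?C'\<close> contains
          \<open>C\<close> and equals it by maximality, although \<open>v'\<close> lies only in
          \<open>?C'\<close>.\<close>
        have "\<not> s \<le> k v v'" using v' v N by (auto simp: cluster_def)
        then have "\<not> s \<le> k v' w"
          using w N level_trans[of s v w v'] by (auto simp: sym)
        then have "s' \<le> s" using w(3) by auto
        have "C \<subseteq> ?C'"
        proof
          fix z assume "z \<in> C"
          then have z: "z \<in> N" "s' \<le> k v z"
            using v \<open>s' \<le> s\<close> by (auto simp: cluster_def)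
          have "s' \<le> k v w" using w \<open>s' \<le> s\<close> by (meson order_trans)
          then have "s' \<le> k v' v" using level_trans[of s' v' w v] w N sym[of v w] by simp
          then show "z \<in> ?C'"
            using level_trans[of s' v' v z] z N by (simp add: cluster_def)
        qed
        moreover have "?C' \<in> bad" using s' v' unfolding bad_def by blast
        ultimately have "?C' = C" by (rule max[rotated])
        then show False using v'C' v' by auto
      qed
      then have "(B - C) \<inter> ?C' = B \<inter> ?C'" "(A - C) \<inter> ?C' = A \<inter> ?C'" by auto
      then show "\<exists>s. card ((B - C) \<inter> cluster v' s) \<le> card ((A - C) \<inter> cluster v' s)"
        using s' by metis
    qed (use less.prems in auto)
    moreover have "card B = card (B \<inter> C) + card (B - C)" "card A = card (A \<inter> C) + card (A - C)"
      using fin by (simp_all add: card_Int_Diff)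
    ultimately show ?thesis using le by linarith
  qed simp
qed

text \<open>The sums are the changes of the pair sums when \<open>u\<close> leaves a set with rest
  \<open>A\<close> and joins \<open>B\<close>, either alone or in return for
  \<open>v\<close>.\<close>

lemma exchange_disjoint:
  assumes u: "u \<in> N" "u \<notin> A" "u \<notin> B" and AB: "A \<subseteq> N" "B \<subseteq> N" "A \<inter> B = {}"
  shows "(\<Sum>b\<in>B. k u b) \<le> (\<Sum>a\<in>A. k u a) \<or>
    (\<exists>v\<in>B. (\<Sum>a\<in>A. k v a) + (\<Sum>b\<in>B - {v}. k u b) \<le> (\<Sum>a\<in>A. k u a) + (\<Sum>b\<in>B - {v}. k v b))"
proof -
  have fin: "finite A" "finite B" using AB finite_N by (auto intro: finite_subset)
  have level: "{b \<in> B'. s \<le> k v b} = B' \<inter> cluster v s" if "B' \<subseteq> N" for B' v s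
    using that by (auto simp: cluster_def)
  \<comment> \<open>Levels below \<open>k u v\<close> are left out because there \<open>u\<close>
    and \<open>v\<close> have the same cluster. Strictness leaves room for taking \<open>v\<close>
    out of \<open>B\<close>.\<close>
  define good where
    "good v \<longleftrightarrow> v \<in> B \<and> (\<forall>s\<ge>k u v. card (A \<inter> cluster v s) < card (B \<inter> cluster v s))" for v
  have good_ex: "\<exists>v. good v \<and> s \<le> k u v" if s: "card (A \<inter> cluster u s) < card (B \<inter> cluster u s)" for s
  proof -
    let ?A = "A \<inter> cluster u s" and ?B = "B \<inter> cluster u s"
    \<comment> \<open>Contrapositive of \<open>card_le_if_bad_clusters\<close> inside the cluster of
      \<open>u\<close>. From level \<open>k u v\<close> on, the clusters of \<open>v\<close> lie in
      this cluster, so the restriction does not change the counts.\<close>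
    obtain v where v: "v \<in> ?B" "\<And>t. card (?A \<inter> cluster v t) < card (?B \<inter> cluster v t)"
      using card_le_if_bad_clusters[of ?A ?B] s AB by (meson Int_lower1 not_le order_trans)
    have vN: "v \<in> N" and suv: "s \<le> k u v" using v AB by (auto simp: cluster_def)
    have "cluster v t \<subseteq> cluster u s" if "k u v \<le> t" for t
    proof
      fix w assume "w \<in> cluster v t"
      then have "w \<in> N" "s \<le> k v w" using that suv by (auto simp: cluster_def)
      then show "w \<in> cluster u s" using level_trans[OF suv] u vN by (simp add: cluster_def)
    qed
    then have "?A \<inter> cluster v t = A \<inter> cluster v t \<and> ?B \<inter> cluster v t = B \<inter> cluster v t"
      if "k u v \<le> t" for t using that by blast
    then have "good v" using v unfolding good_def by (metis IntD1)
    then show ?thesis using suv by blast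
  qed
  show ?thesis
  proof (cases "\<exists>v. good v")
    case False
    then have "card (B \<inter> cluster u s) \<le> card (A \<inter> cluster u s)" for s
      using good_ex by (meson not_le)
    then have "(\<Sum>b\<in>B. k u b) \<le> (\<Sum>a\<in>A. k u a)"
      using fin AB u nonneg by (intro sum_le_of_level_counts) (auto simp: level)
    then show ?thesis ..
  next
    case True
    have "finite (Collect good)" "Collect good \<noteq> {}"
      using True fin unfolding good_def by auto
    then have "Max (k u ` Collect good) \<in> k u ` Collect good"
      by (intro Max_in) auto
    then obtain v where gv: "good v" and vmax: "k u v = Max (k u ` Collect good)" by auto
    \<comment> \<open>Maximality of \<open>k u v\<close> means, by \<open>good_ex\<close>, that
      above this level no cluster of \<open>u\<close> has more points of \<open>B\<close> than of
      \<open>A\<close>.\<close>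
    have max: "k u v' \<le> k u v" if "good v'" for v'
      unfolding vmax using that \<open>finite (Collect good)\<close> by simp
    have v: "v \<in> B" "v \<in> N" using gv AB unfolding good_def by auto
    \<comment> \<open>Each side of the inequality is written as one sum over the same set, so that
      level counts apply to it.\<close>
    let ?W = "A \<union> (B - {v})"
    let ?f = "\<lambda>w. if w \<in> A then k v w else k u w" and ?g = "\<lambda>w. if w \<in> A then k u w else k v w"
    have "sum ?f ?W \<le> sum ?g ?W"
    proof (rule sum_le_of_level_counts)
      fix s
      show "card {w \<in> ?W. s \<le> ?f w} \<le> card {w \<in> ?W. s \<le> ?g w}"
      proof (cases "s \<le> k u v")
        \<comment> \<open>Up to the level \<open>k u v\<close> the points \<open>u\<close> and \<open>v\<close> share their clusters; above it, each
          of the two parts of the sum is compared separately.\<close>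
        case True
        then have "{w \<in> ?W. s \<le> ?f w} = {w \<in> ?W. s \<le> ?g w}"
          using level_eq[OF True] u v AB by auto
        then show ?thesis by simp
      next
        case False
        have split: "{w \<in> ?W. s \<le> ?f w} = (A \<inter> cluster v s) \<union> ((B - {v}) \<inter> cluster u s)"
          "{w \<in> ?W. s \<le> ?g w} = (A \<inter> cluster u s) \<union> ((B - {v}) \<inter> cluster v s)"
          using AB by (auto simp: cluster_def)
        have "v \<notin> cluster u s" using False by (simp add: cluster_def)
        then have "(B - {v}) \<inter> cluster u s = B \<inter> cluster u s" by auto
        moreover have "card (B \<inter> cluster u s) \<le> card (A \<inter> cluster u s)"
          using good_ex[of s] max False by (meson not_le order_trans)
        moreover have "card (A \<inter> cluster v s) < card (B \<inter> cluster v s)"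
          using gv False unfolding good_def by auto
        \<comment> \<open>As \<open>k v v = \<infinity>\<close>, removing \<open>v\<close> from
          \<open>B\<close> costs exactly one point of this cluster, which the strict inequality
          absorbs.\<close>
        moreover have "v \<in> B \<inter> cluster v s" using v self by (simp add: cluster_def)
        then have "card (B \<inter> cluster v s) = Suc (card ((B - {v}) \<inter> cluster v s))"
          using fin card.remove[of "B \<inter> cluster v s" v] by (simp add: Int_Diff Diff_Int_distrib2)
        ultimately show ?thesis
          unfolding split using fin AB
          by (subst (1 2) card_Un_disjoint) auto
      qed
    qed (use fin AB u v nonneg in auto)
    moreover have "sum ?f ?W = (\<Sum>a\<in>A. k v a) + (\<Sum>b\<in>B - {v}. k u b)"
      "sum ?g ?W = (\<Sum>a\<in>A. k u a) + (\<Sum>b\<in>B - {v}. k v b)"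
    proof -
      have "A \<inter> (B - {v}) = {}" using AB by auto
      moreover have "sum ?f (B - {v}) = (\<Sum>b\<in>B - {v}. k u b)" "sum ?g (B - {v}) = (\<Sum>b\<in>B - {v}. k v b)"
        using AB(3) by (auto simp: disjoint_iff split: if_splits intro!: sum.cong)
      ultimately show "sum ?f ?W = (\<Sum>a\<in>A. k v a) + (\<Sum>b\<in>B - {v}. k u b)"
        "sum ?g ?W = (\<Sum>a\<in>A. k u a) + (\<Sum>b\<in>B - {v}. k v b)"
        using fin by (simp_all add: sum.union_disjoint)
    qed
    ultimately show ?thesis using v by auto
  qed
qed

text \<open>Common points of \<open>A\<close> and \<open>B\<close> contribute equally to both sides:
  their sums for \<open>u\<close>, and in a swap also those for \<open>v\<close>, are added to the
  disjoint case. Nothing is cancelled, so infinite values do no harm.\<close>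

lemma exchange:
  assumes u: "u \<in> N" "u \<notin> A" "u \<notin> B" and AB: "A \<subseteq> N" "B \<subseteq> N"
  shows "(\<Sum>b\<in>B. k u b) \<le> (\<Sum>a\<in>A. k u a) \<or>
    (\<exists>v\<in>B - A. (\<Sum>a\<in>A. k v a) + (\<Sum>b\<in>B - {v}. k u b) \<le> (\<Sum>a\<in>A. k u a) + (\<Sum>b\<in>B - {v}. k v b))"
proof -
  have fin: "finite A" "finite B" using AB finite_N by (auto intro: finite_subset)
  have A: "(\<Sum>a\<in>A. k z a) = (\<Sum>a\<in>A \<inter> B. k z a) + (\<Sum>a\<in>A - B. k z a)" for z
    using fin(1) by (rule sum.Int_Diff)
  have B: "(\<Sum>b\<in>B. k z b) = (\<Sum>b\<in>A \<inter> B. k z b) + (\<Sum>b\<in>B - A. k z b)" for z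
    using fin by (subst sum.Int_Diff[of B _ A]) (auto simp: Int_commute)
  have Bv: "(\<Sum>b\<in>B - {v}. k z b) = (\<Sum>b\<in>A \<inter> B. k z b) + (\<Sum>b\<in>B - A - {v}. k z b)"
    if "v \<in> B - A" for z v
  proof -
    have "B - {v} = (A \<inter> B) \<union> (B - A - {v})" using that by auto
    then show ?thesis using fin by (subst sum.union_disjoint[symmetric]) auto
  qed
  consider "(\<Sum>b\<in>B - A. k u b) \<le> (\<Sum>a\<in>A - B. k u a)"
    | v where "v \<in> B - A" "(\<Sum>a\<in>A - B. k v a) + (\<Sum>b\<in>B - A - {v}. k u b)
        \<le> (\<Sum>a\<in>A - B. k u a) + (\<Sum>b\<in>B - A - {v}. k v b)"
    using exchange_disjoint[of u "A - B" "B - A"] assms by blast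
  then show ?thesis
  proof cases
    case 1
    then show ?thesis unfolding A B by (auto intro: add_left_mono)
  next
    case 2
    have "(\<Sum>a\<in>A. k v a) + (\<Sum>b\<in>B - {v}. k u b) \<le> (\<Sum>a\<in>A. k u a) + (\<Sum>b\<in>B - {v}. k v b)"
      using add_left_mono[OF 2(2), of "(\<Sum>a\<in>A \<inter> B. k u a) + (\<Sum>a\<in>A \<inter> B. k v a)"]
      unfolding A Bv[OF 2(1)] by (simp add: ac_simps)
    then show ?thesis using 2 by blast
  qed
qed

end

section \<open>Quadratic functions on the cube as set functions\<close>

definition pair_sum :: "('a set \<Rightarrow> ereal) \<Rightarrow> 'a set \<Rightarrow> ereal" where
  "pair_sum h X = (\<Sum>e\<in>unordered_pairs X. h e)"

lemma finite_unordered_pairs: "finite X \<Longrightarrow> finite (unordered_pairs X)"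
  unfolding unordered_pairs_def by simp

lemma unordered_pairs_insert:
  assumes "v \<notin> X"
  shows "unordered_pairs (insert v X) = unordered_pairs X \<union> (\<lambda>w. {v, w}) ` X"
proof -
  have "\<exists>w\<in>X. e = {v, w}" if "e \<subseteq> insert v X" "card e = 2" "\<not> e \<subseteq> X" for e
  proof -
    obtain a b where "e = {a, b}" "a \<noteq> b" using \<open>card e = 2\<close> by (auto simp: card_2_iff)
    then show ?thesis using that by auto
  qed
  then show ?thesis
    using assms unfolding unordered_pairs_def by (auto simp: card_2_iff)
qed

lemma pair_sum_insert:
  assumes "finite X" "v \<notin> X"
  shows "pair_sum h (insert v X) = pair_sum h X + (\<Sum>w\<in>X. h {v, w})"
proof -
  have "inj_on (\<lambda>w. {v, w}) X" by (auto simp: inj_on_def doubleton_eq_iff)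
  moreover have "unordered_pairs X \<inter> (\<lambda>w. {v, w}) ` X = {}"
    using assms unfolding unordered_pairs_def by auto
  ultimately show ?thesis
    unfolding pair_sum_def unordered_pairs_insert[OF assms(2)]
    using assms by (subst sum.union_disjoint) (auto simp: finite_unordered_pairs sum.reindex)
qed

lemma pair_sum_singleton: "pair_sum h {v} = 0"
proof -
  have "unordered_pairs {v} = {}" by (auto simp: unordered_pairs_def card_2_iff)
  then show ?thesis by (simp add: pair_sum_def)
qed

lemma pair_sum_doubleton: "u \<noteq> v \<Longrightarrow> pair_sum h {u, v} = h {u, v}"
  by (simp add: pair_sum_insert pair_sum_singleton)

text \<open>A pair not contained in \<open>X\<close> has product zero, which by
  \<open>0 * \<infinity> = 0\<close> removes even an infinite coefficient. Prescribing
  \<open>x\<close> pointwise on \<open>N\<close> makes the lemma fit the shifted vectors of the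
  exchange axiom directly.\<close>

lemma quadratic_fun_eq_pair_sum:
  assumes "finite N" "\<And>w. w \<in> N \<Longrightarrow> x w = (if w \<in> X then 1 else 0)" "X \<subseteq> N"
  shows "quadratic_fun N l h x = ereal (\<Sum>u\<in>X. l u) + pair_sum h X"
proof -
  have "(\<Sum>u\<in>N. ereal (l u * of_int (x u))) = (\<Sum>u\<in>X. ereal (l u))"
    using assms by (intro sum.mono_neutral_cong_right) auto
  moreover have "(\<Sum>e\<in>unordered_pairs N. h e * ereal (of_int (\<Prod>w\<in>e. x w))) = pair_sum h X"
    unfolding pair_sum_def
  proof (intro sum.mono_neutral_cong_right)
    show "\<forall>e\<in>unordered_pairs N - unordered_pairs X. h e * ereal (of_int (\<Prod>w\<in>e. x w)) = 0"
    proof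
      fix e assume e: "e \<in> unordered_pairs N - unordered_pairs X"
      then obtain w where "w \<in> e" "w \<in> N" "w \<notin> X" by (auto simp: unordered_pairs_def)
      moreover have "finite e"
        using e assms(1) by (auto simp: unordered_pairs_def intro: finite_subset)
      ultimately have "(\<Prod>w\<in>e. x w) = 0" using assms(2)[of w] by (auto intro!: prod_zero bexI[of _ w])
      then show "h e * ereal (of_int (\<Prod>w\<in>e. x w)) = 0" by simp
    qed
    fix e assume "e \<in> unordered_pairs X"
    then have "(\<Prod>w\<in>e. x w) = 1"
      using assms by (intro prod.neutral) (auto simp: unordered_pairs_def subset_iff)
    then show "h e * ereal (of_int (\<Prod>w\<in>e. x w)) = h e" by (simp flip: one_ereal_def)
  qed (use assms in \<open>auto simp: finite_unordered_pairs unordered_pairs_def\<close>)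
  ultimately show ?thesis unfolding quadratic_fun_def by simp
qed

text \<open>Vectors of the cube are indicators of subsets of \<open>N\<close>. The choice
  \<open>None\<close> moves \<open>u\<close> from \<open>X\<close> to \<open>Y\<close>; the choice
  \<open>Some v\<close> swaps \<open>u\<close> and \<open>v\<close>.\<close>

lemma M_natural_convex_quadratic_iff:
  fixes l :: "'a \<Rightarrow> real" and h :: "'a set \<Rightarrow> ereal"
  assumes "finite N"
  defines "G \<equiv> \<lambda>X. ereal (\<Sum>u\<in>X. l u) + pair_sum h X"
  shows "M_natural_convex N (quadratic_fun N l h) \<longleftrightarrow>
    (\<forall>X\<subseteq>N. G X \<noteq> -\<infinity>) \<and>
    (\<forall>X\<subseteq>N. \<forall>Y\<subseteq>N. \<forall>u\<in>X - Y.
      G (X - {u}) + G (insert u Y) \<le> G X + G Y \<or>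
      (\<exists>v\<in>Y - X. G (insert v (X - {u})) + G (insert u (Y - {v})) \<le> G X + G Y))"
    (is "?L \<longleftrightarrow> ?R1 \<and> ?R2")
proof -
  let ?g = "quadratic_fun N l h"
  define ind :: "'a set \<Rightarrow> 'a \<Rightarrow> int" where
    "ind X = (\<lambda>w\<in>N. if w \<in> X then 1 else 0)" for X
  have cube: "(N \<rightarrow>\<^sub>E {0, 1}) = ind ` Pow N"
  proof (intro equalityI subsetI)
    fix x :: "'a \<Rightarrow> int" assume x: "x \<in> N \<rightarrow>\<^sub>E {0, 1}"
    have "x = ind {w \<in> N. x w = 1}"
      using x by (auto simp: ind_def fun_eq_iff PiE_iff extensional_def)
    then show "x \<in> ind ` Pow N" by auto
  next
    fix x assume "x \<in> ind ` Pow N"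
    then show "x \<in> N \<rightarrow>\<^sub>E {0, 1}" by (auto simp: ind_def split: if_splits)
  qed
  have g: "?g x = G X" if "\<And>w. w \<in> N \<Longrightarrow> x w = (if w \<in> X then 1 else 0)" "X \<subseteq> N" for x X
    unfolding G_def using assms(1) that by (rule quadratic_fun_eq_pair_sum)
  have g_ind: "?g (ind X) = G X" if "X \<subseteq> N" for X
    using that by (intro g) (auto simp: ind_def)
  have gt: "ind Y w < ind X w \<longleftrightarrow> w \<in> X - Y" if "w \<in> N" for X Y w
    using that by (simp add: ind_def)
  have ex: "(\<exists>v \<in> Some ` {v \<in> N. ind Y v > ind X v} \<union> {None}.
        ?g (ind X) + ?g (ind Y) \<ge> ?g (\<lambda>w. ind X w - unit_vec (Some u) w + unit_vec v w) +
                    ?g (\<lambda>w. ind Y w + unit_vec (Some u) w - unit_vec v w)) \<longleftrightarrow>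
      G (X - {u}) + G (insert u Y) \<le> G X + G Y \<or>
      (\<exists>v\<in>Y - X. G (insert v (X - {u})) + G (insert u (Y - {v})) \<le> G X + G Y)"
    if "X \<subseteq> N" "Y \<subseteq> N" "u \<in> X - Y" for X Y u
  proof -
    have "{v \<in> N. ind Y v > ind X v} = Y - X" using that gt by auto
    moreover have "?g (\<lambda>w. ind X w - unit_vec (Some u) w + unit_vec None w) = G (X - {u})"
      "?g (\<lambda>w. ind Y w + unit_vec (Some u) w - unit_vec None w) = G (insert u Y)"
      using that by (auto intro!: g simp: ind_def unit_vec_def)
    moreover have "?g (\<lambda>w. ind X w - unit_vec (Some u) w + unit_vec (Some v) w) = G (insert v (X - {u}))"
      "?g (\<lambda>w. ind Y w + unit_vec (Some u) w - unit_vec (Some v) w) = G (insert u (Y - {v}))"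
      if "v \<in> Y - X" for v
      using \<open>X \<subseteq> N\<close> \<open>Y \<subseteq> N\<close> \<open>u \<in> X - Y\<close> that by (auto intro!: g simp: ind_def unit_vec_def)
    ultimately show ?thesis using that by (auto simp: g_ind)
  qed
  let ?ex = "\<lambda>X Y u. \<exists>v \<in> Some ` {v \<in> N. ind Y v > ind X v} \<union> {None}.
        ?g (ind X) + ?g (ind Y) \<ge> ?g (\<lambda>w. ind X w - unit_vec (Some u) w + unit_vec v w) +
                    ?g (\<lambda>w. ind Y w + unit_vec (Some u) w - unit_vec v w)"
  have "?L \<longleftrightarrow> (\<forall>X\<in>Pow N. ?g (ind X) \<noteq> -\<infinity>) \<and>
    (\<forall>X\<in>Pow N. \<forall>Y\<in>Pow N. \<forall>u\<in>N. ind Y u < ind X u \<longrightarrow> ?ex X Y u)"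
    unfolding M_natural_convex_def cube using assms(1) by simp
  also have "(\<forall>X\<in>Pow N. ?g (ind X) \<noteq> -\<infinity>) \<longleftrightarrow> ?R1"
    using g_ind by auto
  also have "(\<forall>X\<in>Pow N. \<forall>Y\<in>Pow N. \<forall>u\<in>N. ind Y u < ind X u \<longrightarrow> ?ex X Y u) \<longleftrightarrow>
      (\<forall>X\<subseteq>N. \<forall>Y\<subseteq>N. \<forall>u\<in>X - Y. ?ex X Y u)"
    using gt by blast
  also have "\<dots> \<longleftrightarrow> ?R2"
    using ex by (intro all_cong ball_cong refl) auto
  finally show ?thesis .
qed

section \<open>Anti-ultrametric coefficients and M-natural-convexity\<close>

theorem anti_ultrametric_if_M_natural_convex:
  assumes "M_natural_convex N (quadratic_fun N l h)"
    and "u \<in> N" "v \<in> N" "w \<in> N" "u \<noteq> v" "v \<noteq> w" "u \<noteq> w"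
  shows "min (h {u, v}) (h {v, w}) \<le> h {u, w}"
proof -
  have "finite N" using assms(1) by (simp add: M_natural_convex_def)
  define G where "G = (\<lambda>X. ereal (\<Sum>u\<in>X. l u) + pair_sum h X)"
  have "\<forall>X\<subseteq>N. \<forall>Y\<subseteq>N. \<forall>u\<in>X - Y.
      G (X - {u}) + G (insert u Y) \<le> G X + G Y \<or>
      (\<exists>v\<in>Y - X. G (insert v (X - {u})) + G (insert u (Y - {v})) \<le> G X + G Y)"
    using M_natural_convex_quadratic_iff[OF \<open>finite N\<close>, of l h] assms(1) unfolding G_def by blast
  then have "G ({u, w} - {u}) + G {u, v} \<le> G {u, w} + G {v} \<or>
      (\<exists>z\<in>{v} - {u, w}. G (insert z ({u, w} - {u})) + G (insert u ({v} - {z})) \<le> G {u, w} + G {v})"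
    using assms by (metis (no_types, lifting) DiffI empty_subsetI insertCI insert_subset singletonD)
  moreover have "{u, w} - {u} = {w}" using assms by auto
  ultimately have "G {w} + G {u, v} \<le> G {u, w} + G {v} \<or> G {v, w} + G {u} \<le> G {u, w} + G {v}"
    using assms by auto
  \<comment> \<open>The real linear terms agree on both sides and cancel; singletons contribute no
    pairs.\<close>
  then have "h {u, v} \<le> h {u, w} \<or> h {v, w} \<le> h {u, w}"
    using assms unfolding G_def
    by (cases "h {u, v}"; cases "h {u, w}"; cases "h {v, w}")
      (auto simp: pair_sum_singleton pair_sum_doubleton)
  then show ?thesis by (auto simp: min_le_iff_disj)
qed

theorem M_natural_convex_if_anti_ultrametric:
  assumes "finite N"
    and nonneg: "\<And>u v. u \<in> N \<Longrightarrow> v \<in> N \<Longrightarrow> u \<noteq> v \<Longrightarrow> 0 \<le> h {u, v}"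
    and tri: "\<And>u v w. u \<in> N \<Longrightarrow> v \<in> N \<Longrightarrow> w \<in> N \<Longrightarrow> u \<noteq> v \<Longrightarrow> v \<noteq> w \<Longrightarrow> u \<noteq> w \<Longrightarrow>
      min (h {u, v}) (h {v, w}) \<le> h {u, w}"
  shows "M_natural_convex N (quadratic_fun N (\<lambda>_. 0) h)"
proof -
  \<comment> \<open>The infinite diagonal puts each point into all its own clusters. It never enters
    a pair sum, as \<open>ins\<close> only adds points outside the set.\<close>
  define k where "k u v = (if u = v then \<infinity> else h {u, v})" for u v
  interpret anti_ultrametric N k
    by unfold_locales (use assms in \<open>auto simp: k_def insert_commute\<close>)
  have fin: "finite X" if "X \<subseteq> N" for X using that assms(1) by (rule finite_subset)
  have ins: "pair_sum h (insert v X) = pair_sum h X + (\<Sum>w\<in>X. k v w)"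
    if "X \<subseteq> N" "v \<notin> X" for v X
    using that fin by (subst pair_sum_insert) (auto simp: k_def intro!: sum.cong arg_cong2[of _ _ _ _ "(+)"])
  have "pair_sum h X \<ge> 0" if "X \<subseteq> N" for X
    unfolding pair_sum_def
  proof (rule sum_nonneg)
    fix e assume "e \<in> unordered_pairs X"
    then obtain u v where "e = {u, v}" "u \<noteq> v" "{u, v} \<subseteq> X"
      by (auto simp: unordered_pairs_def card_2_iff)
    then have "e = {u, v}" "u \<noteq> v" "u \<in> N" "v \<in> N" using that by auto
    then show "0 \<le> h e" using assms(2) by simp
  qed
  moreover have "pair_sum h (X - {u}) + pair_sum h (insert u Y) \<le> pair_sum h X + pair_sum h Y \<or>
      (\<exists>v\<in>Y - X. pair_sum h (insert v (X - {u})) + pair_sum h (insert u (Y - {v}))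
        \<le> pair_sum h X + pair_sum h Y)"
    if XY: "X \<subseteq> N" "Y \<subseteq> N" and u: "u \<in> X - Y" for X Y u
  proof -
    let ?A = "X - {u}"
    have X: "pair_sum h X = pair_sum h ?A + (\<Sum>w\<in>?A. k u w)"
      using ins[of ?A u] XY u by (auto simp: insert_absorb)
    consider "(\<Sum>b\<in>Y. k u b) \<le> (\<Sum>a\<in>?A. k u a)"
      | v where "v \<in> Y - ?A" "(\<Sum>a\<in>?A. k v a) + (\<Sum>b\<in>Y - {v}. k u b)
          \<le> (\<Sum>a\<in>?A. k u a) + (\<Sum>b\<in>Y - {v}. k v b)"
      using exchange[of u ?A Y] XY u by blast
    then show ?thesis
    proof cases
      case 1
      have "pair_sum h (insert u Y) = pair_sum h Y + (\<Sum>b\<in>Y. k u b)"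
        using XY u by (intro ins) auto
      then have "pair_sum h ?A + pair_sum h (insert u Y) \<le> pair_sum h X + pair_sum h Y"
        using add_left_mono[OF 1, of "pair_sum h ?A + pair_sum h Y"] X by (simp add: ac_simps)
      then show ?thesis ..
    next
      case 2
      have v: "v \<in> Y - X" using 2 u by auto
      let ?B = "Y - {v}"
      have "pair_sum h (insert v ?A) = pair_sum h ?A + (\<Sum>a\<in>?A. k v a)"
        "pair_sum h (insert u ?B) = pair_sum h ?B + (\<Sum>b\<in>?B. k u b)"
        using XY u v by (auto intro!: ins)
      moreover have "pair_sum h Y = pair_sum h ?B + (\<Sum>b\<in>?B. k v b)"
        using ins[of ?B v] XY v by (auto simp: insert_absorb)
      ultimately have "pair_sum h (insert v ?A) + pair_sum h (insert u ?B) \<le> pair_sum h X + pair_sum h Y"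
        using add_left_mono[OF 2(2), of "pair_sum h ?A + pair_sum h ?B"] X by (simp add: ac_simps)
      then show ?thesis using v by blast
    qed
  qed
  ultimately show ?thesis
    unfolding M_natural_convex_quadratic_iff[OF assms(1)]
    by (force simp flip: zero_ereal_def)
qed

section \<open>Completing the cost family\<close>

theorem theorem3:
  fixes r :: nat
    and d :: "nat \<Rightarrow> nat"
    and D :: "nat \<Rightarrow> nat set"
    and c1 :: "nat \<Rightarrow> nat \<Rightarrow> real"
    and c2 :: "nat \<Rightarrow> nat \<Rightarrow> nat \<Rightarrow> nat \<Rightarrow> ereal"
    and f :: "(nat \<Rightarrow> nat) \<Rightarrow> ereal"
    and U :: "(nat \<times> nat) set"
  assumes "r \<ge> 2"
    and "\<And>i. i \<in> {1..r} \<Longrightarrow> d i \<ge> 2"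
    and "\<And>i. i \<in> {1..r} \<Longrightarrow> D i = {1..d i}"
    and "\<And>i a. i \<in> {1..r} \<Longrightarrow> a \<in> D i \<Longrightarrow> c1 i a \<ge> 0"
    and "\<And>i j a b. i \<in> {1..r} \<Longrightarrow> j \<in> {1..r} \<Longrightarrow> i \<noteq> j \<Longrightarrow> a \<in> D i \<Longrightarrow> b \<in> D j \<Longrightarrow>
           c2 i j a b \<ge> 0"
    and "\<And>i j a b. i \<in> {1..r} \<Longrightarrow> j \<in> {1..r} \<Longrightarrow> i \<noteq> j \<Longrightarrow> a \<in> D i \<Longrightarrow> b \<in> D j \<Longrightarrow>
           c2 i j a b = c2 j i b a"
    and "\<And>x. x \<in> Pi\<^sub>E {1..r} D \<Longrightarrow>
           f x = (\<Sum>i\<in>{1..r}. ereal (c1 i (x i))) +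
                 (\<Sum>(i, j)\<in>{(i, j). 1 \<le> i \<and> i < j \<and> j \<le> r}. c2 i j (x i) (x j))"
    and "U = {(i, a). i \<in> {1..r} \<and> a \<in> D i}"
  shows "M_natural_convex_completable U (cost_family c2) \<longleftrightarrow>
         joint_winner_property r D c2 \<and> Z_free r D c2"
proof
  assume "M_natural_convex_completable U (cost_family c2)"
  then obtain h l where agree: "\<forall>u\<in>U. \<forall>v\<in>U. \<forall>t. u \<noteq> v \<and> cost_family c2 u v = Some t \<longrightarrow> h {u, v} = t"
    and M: "M_natural_convex U (quadratic_fun U l h)"
    unfolding M_natural_convex_completable_def by blast
  have h: "h {(i, a), (j, b)} = c2 i j a b"
    if "i \<in> {1..r}" "j \<in> {1..r}" "i \<noteq> j" "a \<in> D i" "b \<in> D j" for i j a b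
    using agree that assms(8) by (auto simp: cost_family_def)
  note tri = anti_ultrametric_if_M_natural_convex[OF M]
  have "joint_winner_property r D c2"
    unfolding joint_winner_property_def
  proof (intro ballI impI)
    fix i j k a b e
    assume *: "i \<in> {1..r}" "j \<in> {1..r}" "k \<in> {1..r}" "i \<noteq> j \<and> j \<noteq> k \<and> i \<noteq> k"
      "a \<in> D i" "b \<in> D j" "e \<in> D k"
    have "min (h {(i, a), (k, e)}) (h {(k, e), (j, b)}) \<le> h {(i, a), (j, b)}"
      using * assms(8) by (intro tri) auto
    then show "min (c2 j k b e) (c2 i k a e) \<le> c2 i j a b"
      using * h[of i k a e] h[of j k b e] h[of i j a b] by (simp add: insert_commute min.commute)
  qed
  moreover have "Z_free r D c2"
    unfolding Z_free_altdef
  proof (intro ballI impI)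
    fix i j a b p q
    assume *: "i \<in> {1..r}" "j \<in> {1..r}" "i \<noteq> j" "a \<in> D i" "b \<in> D i" "p \<in> D j" "q \<in> D j"
      "a \<noteq> b \<and> p \<noteq> q"
    \<comment> \<open>The second triangle bounds the entry of \<open>(j, q)\<close> and
      \<open>(j, p)\<close>, undefined in the family, from below; this bound replaces it in the
      first.\<close>
    have "min (h {(i, a), (j, q)}) (h {(j, q), (j, p)}) \<le> h {(i, a), (j, p)}"
      "min (h {(j, q), (i, b)}) (h {(i, b), (j, p)}) \<le> h {(j, q), (j, p)}"
      using * assms(8) by (auto intro!: tri)
    then show "min (c2 i j a q) (min (c2 i j b p) (c2 i j b q)) \<le> c2 i j a p"
      using * h[of i j a q] h[of i j a p] h[of i j b p] h[of i j b q]
      by (auto simp: insert_commute min_le_iff_disj)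
  qed
  ultimately show "joint_winner_property r D c2 \<and> Z_free r D c2" ..
next
  assume "joint_winner_property r D c2 \<and> Z_free r D c2"
  then have JWP: "joint_winner_property r D c2" and Z: "Z_free r D c2" by auto
  define c where "c u w = c2 (fst u) (fst w) (snd u) (snd w)" for u w
  \<comment> \<open>Every anti-ultrametric completion is at least each of these minima for distinct
    \<open>u\<close>, \<open>v\<close> in one part, so the supremum is the least candidate.\<close>
  define k where "k u v = (if fst u \<noteq> fst v then c u v
    else SUP w\<in>{w \<in> U. fst w \<noteq> fst u}. min (c u w) (c v w))" for u v
  have U: "u \<in> U \<longleftrightarrow> fst u \<in> {1..r} \<and> snd u \<in> D (fst u)" for u
    using assms(8) by (cases u) auto
  have "finite U"
  proof -
    have "U = Sigma {1..r} D" using assms(8) by auto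
    then show ?thesis using assms(3) by (auto intro!: finite_SigmaI)
  qed
  have c_sym: "c u v = c v u" if "u \<in> U" "v \<in> U" "fst u \<noteq> fst v" for u v
    using that assms(6) unfolding c_def U by blast
  have c_nonneg: "0 \<le> c u v" if "u \<in> U" "v \<in> U" "fst u \<noteq> fst v" for u v
    using that assms(5) unfolding c_def U by blast
  have k_sym: "k u v = k v u" if "u \<in> U" "v \<in> U" for u v
    using that c_sym by (auto simp: k_def min.commute)
  \<comment> \<open>A second part exists since \<open>r \<ge> 2\<close>. This keeps the supremum in
    \<open>k\<close> from ranging over the empty set, where it would be
    \<open>-\<infinity>\<close>.\<close>
  have other: "\<exists>w\<in>U. fst w \<noteq> fst u" for u
  proof -
    obtain i where i: "i \<in> {1..r}" "i \<noteq> fst u"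
    proof (cases "fst u = 1")
      case True
      then show ?thesis using assms(1) that[of 2] by auto
    next
      case False
      then show ?thesis using assms(1) that[of 1] by auto
    qed
    moreover have "1 \<in> D i" using i assms(2)[of i] assms(3)[of i] by auto
    ultimately show ?thesis using U[of "(i, 1)"] by (intro bexI[of _ "(i, 1)"]) auto
  qed
  have k_ge: "min (c u w) (c v w) \<le> k u v"
    if "w \<in> U" "fst w \<noteq> fst u" "fst u = fst v" for u v w
    using that unfolding k_def by (auto intro!: SUP_upper)
  have k_attained: "\<exists>w\<in>U. fst w \<noteq> fst u \<and> k u v = min (c u w) (c v w)"
    if "fst u = fst v" for u v
  proof -
    let ?W = "{w \<in> U. fst w \<noteq> fst u}"
    have "?W \<noteq> {}" "finite ?W" using other[of u] \<open>finite U\<close> by auto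
    then have "(SUP w\<in>?W. min (c u w) (c v w)) \<in> (\<lambda>w. min (c u w) (c v w)) ` ?W"
      by (metis (no_types, lifting) finite_imageI image_is_empty Max_Sup Max_in)
    then show ?thesis using that unfolding k_def by auto
  qed
  have k_nonneg: "0 \<le> k u v" if "u \<in> U" "v \<in> U" for u v
  proof (cases "fst u = fst v")
    case True
    then obtain w where "w \<in> U" "fst w \<noteq> fst u" "k u v = min (c u w) (c v w)"
      using k_attained by blast
    then show ?thesis using True that c_nonneg by auto
  qed (use that c_nonneg in \<open>auto simp: k_def\<close>)
  have jwp: "min (c u v) (c v w) \<le> c u w"
    if "u \<in> U" "v \<in> U" "w \<in> U" "fst u \<noteq> fst v" "fst v \<noteq> fst w" "fst u \<noteq> fst w" for u v w
  proof -
    have "min (c w v) (c u v) \<le> c u w"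
      using JWP that unfolding joint_winner_property_def c_def U by metis
    then show ?thesis using c_sym that by (metis min.commute)
  qed
  have zfree: "min (c u w') (min (c v w) (c v w')) \<le> c u w"
    if "u \<in> U" "v \<in> U" "w \<in> U" "w' \<in> U" "fst u = fst v" "fst w = fst w'" "fst u \<noteq> fst w"
      "u \<noteq> v" "w \<noteq> w'" for u v w w'
  proof -
    have "snd u \<noteq> snd v" "snd w \<noteq> snd w'" using that by (auto simp: prod_eq_iff)
    then show ?thesis
      using Z that unfolding Z_free_altdef c_def U by metis
  qed
  \<comment> \<open>Let \<open>z\<close> attain \<open>k u v\<close>. If \<open>z\<close> lies in
    the part of \<open>w\<close>, Z-freeness of the block on \<open>u\<close>, \<open>v\<close> and
    \<open>w\<close>, \<open>z\<close> applies unless \<open>z = w\<close>. Otherwise the joint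
    winner property bounds first \<open>c z w\<close> through \<open>v\<close>, then
    \<open>c u w\<close> through \<open>z\<close>.\<close>
  have cross: "min (k u v) (c v w) \<le> c u w"
    if uvw: "u \<in> U" "v \<in> U" "w \<in> U" "fst u = fst v" "fst u \<noteq> fst w" "u \<noteq> v" for u v w
  proof -
    obtain z where z: "z \<in> U" "fst z \<noteq> fst u" "k u v = min (c u z) (c v z)"
      using k_attained \<open>fst u = fst v\<close> by blast
    show ?thesis
    proof (cases "fst z = fst w")
      case True
      show ?thesis
      proof (cases "z = w")
        case False
        then show ?thesis using zfree[of u v w z] uvw z True
          by (auto simp: min_le_iff_disj)
      qed (use z in \<open>auto simp: min_le_iff_disj\<close>)
    next
      case False
      have "min (c z v) (c v w) \<le> c z w" using uvw z False by (intro jwp) auto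
      moreover have "min (c u z) (c z w) \<le> c u w" using uvw z False by (intro jwp) auto
      moreover have "c z v = c v z" using uvw z by (intro c_sym) auto
      ultimately show ?thesis using z(3) by (auto simp: min_le_iff_disj)
    qed
  qed
  have tri: "min (k u v) (k v w) \<le> k u w"
    if uvw: "u \<in> U" "v \<in> U" "w \<in> U" "u \<noteq> v" "v \<noteq> w" "u \<noteq> w" for u v w
  proof -
    consider "fst u \<noteq> fst v" "fst v \<noteq> fst w" "fst u \<noteq> fst w"
      | "fst u = fst v" "fst v \<noteq> fst w"
      | "fst u \<noteq> fst v" "fst v = fst w"
      | "fst u \<noteq> fst v" "fst u = fst w"
      | "fst u = fst v" "fst v = fst w" by fastforce
    then show ?thesis
    proof cases
      case 1
      then show ?thesis using jwp uvw by (simp add: k_def)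
    next
      case 2
      then show ?thesis using cross[of u v w] uvw by (simp add: k_def[of v w] k_def[of u w])
    next
      case 3
      then show ?thesis
        using cross[of w v u] uvw k_sym[of v w] c_sym[of u v] c_sym[of u w]
        by (simp add: k_def[of u v] k_def[of u w] min.commute)
    next
      case 4
      then show ?thesis
        using k_ge[of v u w] uvw c_sym[of v w] by (simp add: k_def[of u v] k_def[of v w])
    next
      case 5
      \<comment> \<open>With all three points in one part, the point \<open>z\<close> attaining
        \<open>k u v\<close> also serves as a candidate for \<open>k u w\<close>, because
        \<open>cross\<close> bounds \<open>c w z\<close> from below.\<close>
      obtain z where z: "z \<in> U" "fst z \<noteq> fst u" "k u v = min (c u z) (c v z)"
        using k_attained[of u v] 5 by auto
      have "min (k w v) (c v z) \<le> c w z" using 5 z uvw by (intro cross) auto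
      moreover have "min (c u z) (c w z) \<le> k u w" using 5 z by (intro k_ge) auto
      ultimately show ?thesis
        using z(3) k_sym[of v w] uvw by (auto simp: min_le_iff_disj)
    qed
  qed
  \<comment> \<open>Passage from ordered to unordered pairs: the infimum runs over both orderings of
    \<open>e\<close>, whose values agree on \<open>U\<close> by \<open>k_sym\<close>.\<close>
  define h where "h e = (INF p\<in>{(u, v). e = {u, v}}. case_prod k p)" for e
  have h: "h {u, v} = k u v" if "u \<in> U" "v \<in> U" for u v
  proof -
    have "{(x, y). {u, v} = {x, y}} = {(u, v), (v, u)}" by (auto simp: doubleton_eq_iff)
    then show ?thesis using k_sym[OF that] unfolding h_def by simp
  qed
  have "M_natural_convex U (quadratic_fun U (\<lambda>_. 0) h)"
    using \<open>finite U\<close> h k_nonneg tri by (intro M_natural_convex_if_anti_ultrametric) auto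
  moreover have "\<forall>e\<in>unordered_pairs U. h e \<noteq> -\<infinity>"
    using h k_nonneg by (force simp: unordered_pairs_def card_2_iff)
  moreover have "\<forall>u\<in>U. \<forall>v\<in>U. \<forall>t. u \<noteq> v \<and> cost_family c2 u v = Some t \<longrightarrow> h {u, v} = t"
    using h by (auto simp: cost_family_def k_def c_def split: if_splits)
  ultimately show "M_natural_convex_completable U (cost_family c2)"
    unfolding M_natural_convex_completable_def by blast
qed

end
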